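(* Let $(E,+,\leq)$ be a nontrivial linearly ordered monoid such that the semigroup $(E,+)$ is not a hyperspace. Then $(E,+,\leq)$ is Archimedean in the sense that $$\exists\, u\in E_+ \ \ \forall\, x\in E\ \ \exists\, n\in\mathbb{N}:\ \ n u\geq x .$$
   Context: A partially ordered monoid $(E,+,\leq)$ is a monoid $(E,+)$, with neutral element $0$, equipped with a partial order $\leq$ compatible with $+$; in particular $x,y\in E_+$ implies $x+y\in E_+$, where $E_+=\{x\in E : x\geq 0\}$. It is linearly ordered if $\leq$ is a linear (total) order. Nontrivial means $E\neq\{0\}$. For $n\in\mathbb{N}$ and $u\in E$, $nu$ denotes the $n$-fold sum $u+\cdots+u$ (with $0u=0$). Two sub-semigroups of a semigroup $(E,* )$ are called disjoint if and only if their intersection is empty or is a set of idempotent elements (elements $e$ with $e*e=e$). A semigroup $(E,* )$ is called a hyperspace if and only if it contains a sub-semigroup $F\subsetneqq E$ together with an infinite set $\mathcal{I}$ of pairwise disjoint (in the sense that the intersection of any two distinct members of $\mathcal{I}$ is empty or is a set of idempotent elements) sub-semigroups $I\subsetneqq F$. *)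

theory Defs
  imports Main
begin

text \<open>
  The ordered structures of HOL are all commutative; the monoids considered here need not be.
\<close>

class ordered_monoid_add = monoid_add + order +
  assumes add_left_mono_monoid: "a \<le> b \<Longrightarrow> c + a \<le> c + b"
    and add_right_mono_monoid: "a \<le> b \<Longrightarrow> a + c \<le> b + c"

class linordered_monoid_add = ordered_monoid_add + linorder

definition nfold :: "nat \<Rightarrow> 'a::monoid_add \<Rightarrow> 'a"
  where "nfold n u = sum_list (replicate n u)"

context semigroup
begin

text \<open>
  Sub-semigroups are nonempty. In the definition of a hyperspace this makes no difference, since
  admitting the empty set would add at most one member to the infinite family.
\<close>

definition subsemigroup :: "'a set \<Rightarrow> bool"
  where "subsemigroup S \<longleftrightarrow> S \<noteq> {} \<and> (\<forall>x\<in>S. \<forall>y\<in>S. f x y \<in> S)"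

definition disjoint_subsemigroups :: "'a set \<Rightarrow> 'a set \<Rightarrow> bool"
  where "disjoint_subsemigroups S T \<longleftrightarrow> S \<inter> T = {} \<or> (\<forall>e\<in>S \<inter> T. f e e = e)"

definition hyperspace :: bool
  where "hyperspace \<longleftrightarrow>
    (\<exists>F \<I>. subsemigroup F \<and> F \<subset> UNIV \<and> infinite \<I> \<and>
      (\<forall>I\<in>\<I>. subsemigroup I \<and> I \<subset> F) \<and> pairwise disjoint_subsemigroups \<I>)"

end

end

theory Submission
  imports Defs
begin

text \<open>
  If no \<open>u \<ge> 0\<close> is an order unit, then there are \<open>0 < u\<^sub>1 < u\<^sub>2 < \<dots>\<close> with each \<open>u\<^sub>k\<^sub>+\<^sub>1\<close> above
  all multiples of \<open>u\<^sub>k\<close>. The cyclic semigroups generated by the \<open>u\<^sub>k\<close> are then pairwise disjoint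
  and infinitely many, and all lie strictly inside the proper sub-semigroup of positive elements.
\<close>

lemma nfold_0 [simp]: "nfold 0 u = 0"
  by (simp add: nfold_def)

lemma nfold_Suc [simp]: "nfold (Suc n) u = u + nfold n u"
  by (simp add: nfold_def)

lemma nfold_add: "nfold (m + n) u = nfold m u + nfold n u"
  by (simp add: nfold_def replicate_add)

lemma nfold_nonneg:
  fixes u :: "'a::ordered_monoid_add"
  assumes "0 \<le> u"
  shows "0 \<le> nfold n u"
proof (induction n)
  case (Suc n)
  have "u + 0 \<le> u + nfold n u"
    using Suc by (rule add_left_mono_monoid)
  with assms show ?case by simp
qed simp

lemma le_nfold_Suc:
  fixes u :: "'a::ordered_monoid_add"
  assumes "0 \<le> u"
  shows "u \<le> nfold (Suc n) u"
  using add_left_mono_monoid[OF nfold_nonneg[OF assms], of u n] by simp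

text \<open>This set will be \<open>F\<close>: closed because \<open>x = x + 0 \<le> x + y\<close>,
  nonempty because of \<open>a\<close>.\<close>

lemma subsemigroup_positive:
  fixes a :: "'a::ordered_monoid_add"
  assumes "0 < a"
  shows "semigroup.subsemigroup (+) {x :: 'a. 0 < x}"
proof -
  have "0 < x + y" if "0 < x" "0 < y" for x y :: 'a
    using add_left_mono_monoid[of 0 y x] that by (simp add: less_le_trans)
  with assms show ?thesis
    by (auto simp: semigroup.subsemigroup_def[OF add.semigroup_axioms])
qed

text \<open>Starting at \<open>Suc n\<close> leaves out the empty sum 0, so that for positive
  \<open>u\<close> the multiples stay within the positive elements.\<close>

lemma subsemigroup_multiples:
  "semigroup.subsemigroup (+) (range (\<lambda>n. nfold (Suc n) u))"
proof -
  have "nfold (Suc m) u + nfold (Suc n) u = nfold (Suc (m + Suc n)) u" for m n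
    by (metis add_Suc nfold_add)
  then show ?thesis
    unfolding semigroup.subsemigroup_def[OF add.semigroup_axioms] by blast
qed

lemma hyperspace_if_not_archimedean:
  assumes "\<And>u::'a::linordered_monoid_add. 0 \<le> u \<Longrightarrow> \<exists>x. \<forall>n. nfold n u < x"
  shows "semigroup.hyperspace ((+) :: 'a \<Rightarrow> 'a \<Rightarrow> 'a)"
proof -
  obtain g :: "'a \<Rightarrow> 'a" where g: "\<And>u n. 0 \<le> u \<Longrightarrow> nfold n u < g u"
    using assms by metis
  have g_pos: "0 < g u" if "0 \<le> u" for u
    using g[OF that, of 0] by simp
  \<comment> \<open>The exponent \<open>Suc k\<close> makes the sequence start at
    \<open>g 0\<close>, which is positive, instead of at 0.\<close>
  define v where "v k = (g ^^ Suc k) 0" for k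
  have v_Suc: "v (Suc k) = g (v k)" for k
    by (simp add: v_def)
  \<comment> \<open>\<open>g\<close> is controlled only at nonnegative arguments, so this must
    precede the bound on multiples of \<open>v k\<close>.\<close>
  have v_pos: "0 < v k" for k
    by (induction k) (simp_all add: v_Suc g_pos less_imp_le, simp add: v_def g_pos)
  note v_nonneg = v_pos[THEN less_imp_le]
  have nfold_v: "nfold n (v k) < v (Suc k)" for n k
    unfolding v_Suc by (rule g[OF v_nonneg])
  \<comment> \<open>The multiple with \<open>n = 1\<close> is \<open>v k\<close> itself.\<close>
  have "strict_mono v"
    using nfold_v[of "Suc 0"] by (simp add: strict_mono_Suc_iff)
  define I where "I k = range (\<lambda>n. nfold (Suc n) (v k))" for k
  \<comment> \<open>The sets are stacked: all of \<open>I j\<close> lies below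
    \<open>v (Suc j) \<le> v k\<close>, and \<open>v k\<close> is the least element of
    \<open>I k\<close>.\<close>
  have I_less: "x < y" if jk: "j < k" and xy: "x \<in> I j" "y \<in> I k" for j k x y
  proof -
    obtain m n where x: "x = nfold (Suc m) (v j)" and y: "y = nfold (Suc n) (v k)"
      using xy unfolding I_def by blast
    have "x < v (Suc j)"
      unfolding x by (rule nfold_v)
    also have "\<dots> \<le> v k"
      using jk \<open>strict_mono v\<close> by (simp add: strict_mono_less_eq)
    also have "\<dots> \<le> y"
      unfolding y by (rule le_nfold_Suc[OF v_nonneg])
    finally show ?thesis .
  qed
  have disjnt: "I j \<inter> I k = {}" if "j \<noteq> k" for j k
    using that I_less by (metis disjoint_iff less_irrefl nat_neq_iff)
  have v_in: "v k \<in> I k" for k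
    unfolding I_def by (rule range_eqI[of _ _ 0]) simp
  \<comment> \<open>An infinite set of semigroups is required, so the \<open>I k\<close> must be
    distinct; being nonempty and disjoint, they are.\<close>
  have "inj I"
    using disjnt v_in by (metis disjoint_iff injI)
  then have inf_I: "infinite (range I)"
    using finite_imageD[of I UNIV] infinite_UNIV_nat by metis
  have I_psubset: "I k \<subset> {x. 0 < x}" for k
  proof
    show "I k \<subseteq> {x. 0 < x}"
      unfolding I_def using less_le_trans[OF v_pos le_nfold_Suc[OF v_nonneg]] by blast
    \<comment> \<open>The positive element \<open>v (Suc k)\<close> belongs to the next semigroup,
      hence not to \<open>I k\<close>.\<close>
    show "I k \<noteq> {x. 0 < x}"
      using v_pos[of "Suc k"] v_in[of "Suc k"] disjnt[of k "Suc k"] by auto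
  qed
  have pw: "pairwise (semigroup.disjoint_subsemigroups (+)) (range I)"
  proof (rule pairwiseI)
    fix A B
    assume "A \<in> range I" "B \<in> range I" "A \<noteq> B"
    then have "A \<inter> B = {}"
      by (metis disjnt imageE)
    then show "semigroup.disjoint_subsemigroups (+) A B"
      by (simp add: semigroup.disjoint_subsemigroups_def[OF add.semigroup_axioms])
  qed
  have I_sub: "semigroup.subsemigroup (+) (I k)" for k
    unfolding I_def by (rule subsemigroup_multiples)
  have "{x::'a. 0 < x} \<subset> UNIV"
    by (metis less_irrefl mem_Collect_eq psubsetI subset_UNIV UNIV_I)
  moreover have "\<forall>A\<in>range I. semigroup.subsemigroup (+) A \<and> A \<subset> {x. 0 < x}"
    using I_sub I_psubset by (metis imageE)
  ultimately show ?thesis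
    unfolding semigroup.hyperspace_def[OF add.semigroup_axioms]
    by (intro exI conjI) (rule subsemigroup_positive[OF v_pos[of 0]] inf_I pw | assumption)+
qed

theorem corollary4p1:
  assumes nontrivial: "(UNIV :: 'a::linordered_monoid_add set) \<noteq> {0}"
    and not_hyperspace: "\<not> semigroup.hyperspace ((+) :: 'a \<Rightarrow> 'a \<Rightarrow> 'a)"
  shows "\<exists>u\<in>{u::'a. u \<ge> 0}. \<forall>x::'a. \<exists>n::nat. nfold n u \<ge> x"
proof (rule ccontr)
  assume "\<not> ?thesis"
  \<comment> \<open>Totality of the order turns the failure of \<open>nfold n u \<ge> x\<close> into
    \<open>nfold n u < x\<close>.\<close>
  then have "\<exists>x. \<forall>n. nfold n u < x" if "0 \<le> u" for u :: 'a
    using that by (metis mem_Collect_eq not_le)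
  with not_hyperspace show False
    using hyperspace_if_not_archimedean by blast
qed

end
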